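(* Let $k\ge 0$ and $r\in\{0,1,2,3\}$ be integers with $4k+r\ge 2$. Then $$\pi_{\mathrm{opt}}(S_{3,4k+r})=3k+r,$$ and $$\pi_{\mathrm{opt}}(S'_{3,4k+r})=\begin{cases}3k+2 & \text{if } r=3,\\ 3k+r & \text{otherwise.}\end{cases}$$
   Context: A pebbling distribution $P$ on a finite simple graph $G$ is a function $P:V(G)\to\mathbb{Z}_{\ge 0}$; its size is $|P|=\sum_{v}P(v)$. A pebbling move from a vertex $u$ having at least two pebbles to a neighbor $v$ of $u$ removes two pebbles from $u$ and adds one pebble to $v$. A vertex $v$ is reachable under $P$ if some (possibly empty) sequence of pebbling moves starting from $P$ yields a distribution with at least one pebble on $v$. $P$ is solvable if every vertex of $G$ is reachable under $P$. The optimal pebbling number $\pi_{\mathrm{opt}}(G)$ is the minimum size of a solvable distribution on $G$. Let $SG$ be the infinite square grid: vertex set $\mathbb{Z}^2$, with $(i,j)$ and $(i',j')$ adjacent iff $|i-i'|+|j-j'|=1$. For $k\in\mathbb{Z}$ let $D^+_k=\{(i,j): i-j=k\}$ (positive diagonal) and $D^-_k=\{(i,j): i+j=k\}$ (negative diagonal). For integers $n\ge 1$ and odd $m$, $S'_{m,n}$ is the subgraph of $SG$ induced by $\left(\bigcup_{j=1}^m D^-_j\right)\cap\left(\bigcup_{i=1}^n D^+_i\right)$, and $S_{m,n}$ is the subgraph induced by $\left(\bigcup_{j=1}^m D^-_j\right)\cap\left(\bigcup_{i=0}^{n-1} D^+_i\right)$. *)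

theory Defs
  imports "Graph_Theory.Graph_Theory"
begin

section \<open>Pebbling\<close>

text \<open>
  Finite simple graphs are the symmetric loop-free finite digraphs of locale \<^locale>\<open>graph\<close>:
  each undirected edge is a pair of opposite arcs. A distribution, a function on the vertex set,
  is represented as a function on the whole vertex type that vanishes outside the vertex set.
\<close>

definition pebbling_distribution :: "('a, 'b) pre_digraph \<Rightarrow> ('a \<Rightarrow> nat) \<Rightarrow> bool" where
  "pebbling_distribution G P \<longleftrightarrow> (\<forall>v. v \<notin> verts G \<longrightarrow> P v = 0)"

definition distribution_size :: "('a, 'b) pre_digraph \<Rightarrow> ('a \<Rightarrow> nat) \<Rightarrow> nat" where
  "distribution_size G P = (\<Sum>v\<in>verts G. P v)"

definition pebbling_move :: "('a, 'b) pre_digraph \<Rightarrow> ('a \<Rightarrow> nat) \<Rightarrow> ('a \<Rightarrow> nat) \<Rightarrow> bool" where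
  "pebbling_move G P Q \<longleftrightarrow>
     (\<exists>u v. u \<rightarrow>\<^bsub>G\<^esub> v \<and> P u \<ge> 2 \<and> Q = P(u := P u - 2, v := P v + 1))"

definition pebbling_reachable :: "('a, 'b) pre_digraph \<Rightarrow> ('a \<Rightarrow> nat) \<Rightarrow> 'a \<Rightarrow> bool" where
  "pebbling_reachable G P v \<longleftrightarrow> (\<exists>Q. (pebbling_move G)\<^sup>*\<^sup>* P Q \<and> Q v \<ge> 1)"

definition solvable_distribution :: "('a, 'b) pre_digraph \<Rightarrow> ('a \<Rightarrow> nat) \<Rightarrow> bool" where
  "solvable_distribution G P \<longleftrightarrow>
     pebbling_distribution G P \<and> (\<forall>v\<in>verts G. pebbling_reachable G P v)"

definition optimal_pebbling_number :: "('a, 'b) pre_digraph \<Rightarrow> nat" where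
  "optimal_pebbling_number G =
     (LEAST s. \<exists>P. solvable_distribution G P \<and> distribution_size G P = s)"

text \<open>The minimum is attained: one pebble on every vertex is solvable.\<close>

lemma optimal_pebbling_number_attained:
  "\<exists>P. solvable_distribution G P \<and> distribution_size G P = optimal_pebbling_number G"
proof -
  let ?P = "\<lambda>v. if v \<in> verts G then 1 else 0 :: nat"
  have "pebbling_reachable G ?P v" if "v \<in> verts G" for v
    unfolding pebbling_reachable_def using that by (intro exI[of _ ?P]) auto
  then have "solvable_distribution G ?P"
    by (auto simp: solvable_distribution_def pebbling_distribution_def)
  then show ?thesis
    unfolding optimal_pebbling_number_def
    by (intro LeastI[where P = "\<lambda>s. \<exists>P. solvable_distribution G P \<and> distribution_size G P = s"
        and k = "distribution_size G ?P"]) blast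
qed


section \<open>The square grid and its diagonal subgraphs\<close>

definition square_grid :: "(int \<times> int) pair_pre_digraph" where
  "square_grid =
     \<lparr> pverts = UNIV, parcs = {((i, j), (i', j')). \<bar>i - i'\<bar> + \<bar>j - j'\<bar> = 1} \<rparr>"

definition pos_diag :: "int \<Rightarrow> (int \<times> int) set" where
  "pos_diag k = {(i, j). i - j = k}"

definition neg_diag :: "int \<Rightarrow> (int \<times> int) set" where
  "neg_diag k = {(i, j). i + j = k}"

definition S_grid :: "nat \<Rightarrow> nat \<Rightarrow> (int \<times> int, (int \<times> int) \<times> (int \<times> int)) pre_digraph" where
  "S_grid m n = with_proj square_grid \<restriction>
     ((\<Union>j\<in>{1..int m}. neg_diag j) \<inter> (\<Union>i\<in>{0..int n - 1}. pos_diag i))"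

definition S'_grid :: "nat \<Rightarrow> nat \<Rightarrow> (int \<times> int, (int \<times> int) \<times> (int \<times> int)) pre_digraph" where
  "S'_grid m n = with_proj square_grid \<restriction>
     ((\<Union>j\<in>{1..int m}. neg_diag j) \<inter> (\<Union>i\<in>{1..int n}. pos_diag i))"

lemma finite_diag_block:
  "finite ((\<Union>j\<in>{a..b}. neg_diag j) \<inter> (\<Union>i\<in>{c..d}. pos_diag i))" (is "finite ?V")
proof (rule finite_imageD)
  show "finite ((\<lambda>(i, j). (i + j, i - j)) ` ?V)"
    by (rule finite_subset[of _ "{a..b} \<times> {c..d}"]) (auto simp: neg_diag_def pos_diag_def)
  show "inj_on (\<lambda>(i, j). (i + j, i - j)) ?V"
    by (auto simp: inj_on_def)
qed

lemma graph_induced_square_grid: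
  assumes "finite V"
  shows "graph (with_proj square_grid \<restriction> V)"
proof -
  let ?G = "with_proj square_grid \<restriction> V"
  have "arcs ?G \<subseteq> V \<times> V"
    by auto
  then have "finite (arcs ?G)"
    using assms finite_subset by blast
  then show ?thesis
    using assms
    by unfold_locales
      (auto simp: square_grid_def arcs_ends_def arc_to_ends_def symmetric_def sym_def image_iff
        abs_minus_commute)
qed

lemma graph_S_grid: "graph (S_grid m n)"
  and graph_S'_grid: "graph (S'_grid m n)"
  unfolding S_grid_def S'_grid_def
  by (intro graph_induced_square_grid finite_diag_block)+

end

theory Submission
  imports Defs
begin

text \<open>
  In both graphs a column, the set of vertices with a given \<open>i - j\<close>, is a single vertex
  \<open>cen m\<close> if \<open>i - j = 2 m\<close>, and a pair of twins \<open>lo m\<close>, \<open>hi m\<close> if \<open>i - j = 2 m + 1\<close>. Consecutive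
  columns are completely joined, and there are no other edges. The graph is a chain of 4-cycles
  glued at opposite vertices, possibly with a pendant pair at either end.

  Upper bound: put pebbles on the single vertices only, alternately one and two. Every pair is
  then next to a vertex with two pebbles, except possibly a pair in the last column, in which case
  the single vertex before it gets a second pebble (\<open>ones_and_twos_solvable\<close>).

  Lower bound: with \<open>s\<close> single vertices and \<open>p\<close> pairs, a solvable distribution \<open>P\<close> satisfies
  \<open>2 |P| \<ge> 2 s + p\<close>, and rounding up gives the stated values. A column of one vertex can be added
  at either end together with one pebble on it; this raises both sides by 2. So it is enough to
  treat a chain with \<open>K + 1\<close> single vertices and \<open>K\<close> pairs that begins and ends with a single vertex.

  A sequence of moves is relaxed to a flow, which records only how often each arc is used and
  requires that no vertex ends up with a negative number of pebbles. Let \<open>x\<^sub>m\<close> be the number of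
  pebbles on \<open>cen m\<close> and \<open>p\<^sub>m\<close> that on the \<open>m\<close>-th pair, which lies between \<open>cen m\<close> and \<open>cen (m + 1)\<close>.
  Let \<open>R\<^sub>m\<close> and \<open>L\<^sub>m\<close> be the largest net numbers of pebbles that a flow can bring from this pair to
  \<open>cen (m + 1)\<close> and to \<open>cen m\<close>, respectively. What the pair can draw on at its two sides is then
  \<open>q = x\<^sub>m + R\<^sub>m\<^sub>-\<^sub>1\<close> and \<open>t = x\<^sub>m\<^sub>+\<^sub>1 + L\<^sub>m\<^sub>+\<^sub>1\<close>. The core is the local inequality
  \<open>3 + R\<^sub>m + L\<^sub>m \<le> q + t + 2 p\<^sub>m\<close> (\<open>pair_slack\<close>), which holds because both twins
  and both adjacent single vertices can be reached. Summed over all pairs, the terms \<open>R\<close> and \<open>L\<close>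
  telescope, except for \<open>L\<^sub>0\<close> and \<open>R\<^sub>K\<^sub>-\<^sub>1\<close>; these are controlled by
  \<open>1 \<le> x\<^sub>0 + L\<^sub>0\<close> and \<open>1 \<le> x\<^sub>K + R\<^sub>K\<^sub>-\<^sub>1\<close>, which say that the two end vertices can be reached. The
  result is \<open>3 K + 2 \<le> 2 |P|\<close>.
\<close>

section \<open>Pebbling flows\<close>

text \<open>
  The value \<open>f u v\<close> is the number of moves along the arc from \<open>u\<close> to \<open>v\<close>. A move costs two pebbles
  at its tail and yields one at its head.
\<close>

definition flow_gain :: "('a, 'b) pre_digraph \<Rightarrow> ('a \<Rightarrow> 'a \<Rightarrow> nat) \<Rightarrow> 'a \<Rightarrow> int" where
  "flow_gain G f u = (\<Sum>v\<in>verts G. int (f v u) - 2 * int (f u v))"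

text \<open>
  The order of the moves is forgotten. This loses nothing in the direction needed here: conditions
  that every flow satisfies bind every sequence of moves.
\<close>

definition pebbling_flow :: "('a, 'b) pre_digraph \<Rightarrow> ('a \<Rightarrow> nat) \<Rightarrow> ('a \<Rightarrow> 'a \<Rightarrow> nat) \<Rightarrow> bool" where
  "pebbling_flow G P f \<longleftrightarrow>
     (\<forall>u v. f u v \<noteq> 0 \<longrightarrow> u \<rightarrow>\<^bsub>G\<^esub> v) \<and> (\<forall>u\<in>verts G. 0 \<le> int (P u) + flow_gain G f u)"

lemma flow_of_pebbling_moves:
  assumes "graph G" and "(pebbling_move G)\<^sup>*\<^sup>* P Q"
  shows "\<exists>f. (\<forall>u v. f u v \<noteq> 0 \<longrightarrow> u \<rightarrow>\<^bsub>G\<^esub> v) \<and>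
             (\<forall>u\<in>verts G. int (Q u) = int (P u) + flow_gain G f u)"
  using assms(2)
proof (induction rule: rtranclp_induct)
  case base
  show ?case
    by (rule exI[of _ "\<lambda>_ _. 0"]) (simp add: flow_gain_def)
next
  case (step Q R)
  interpret graph G by (rule assms(1))
  obtain f where f: "\<forall>u v. f u v \<noteq> 0 \<longrightarrow> u \<rightarrow>\<^bsub>G\<^esub> v"
    and bal: "\<forall>u\<in>verts G. int (Q u) = int (P u) + flow_gain G f u"
    using step.IH by blast
  obtain a b where ab: "a \<rightarrow>\<^bsub>G\<^esub> b" and "Q a \<ge> 2" and R: "R = Q(a := Q a - 2, b := Q b + 1)"
    using step.hyps(2) unfolding pebbling_move_def by blast
  have "a \<noteq> b" using ab adj_not_same by blast
  have in_verts: "a \<in> verts G" "b \<in> verts G" using ab adj_in_verts by blast+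
  define g where "g = (\<lambda>u v. f u v + (if u = a \<and> v = b then 1 else 0))"
  have "flow_gain G g u = flow_gain G f u + (if u = b then 1 else 0) - (if u = a then 2 else 0)" for u
  proof -
    have "flow_gain G g u = flow_gain G f u +
        (\<Sum>v\<in>verts G. (if v = a then if u = b then 1 else 0 else 0)
                     - (if v = b then if u = a then 2 else 0 else 0))"
      unfolding flow_gain_def sum.distrib[symmetric] g_def by (intro sum.cong) auto
    then show ?thesis
      using in_verts by (simp add: sum_subtractf)
  qed
  then have "\<forall>u\<in>verts G. int (R u) = int (P u) + flow_gain G g u"
    using bal \<open>Q a \<ge> 2\<close> \<open>a \<noteq> b\<close> by (auto simp: R)
  moreover have "\<forall>u v. g u v \<noteq> 0 \<longrightarrow> u \<rightarrow>\<^bsub>G\<^esub> v"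
    using f ab by (auto simp: g_def)
  ultimately show ?case by blast
qed

lemma reachable_imp_flow:
  assumes "graph G" and "pebbling_reachable G P v" and "v \<in> verts G"
  obtains f where "pebbling_flow G P f" and "1 \<le> int (P v) + flow_gain G f v"
proof -
  obtain Q where "(pebbling_move G)\<^sup>*\<^sup>* P Q" and "Q v \<ge> 1"
    using assms(2) unfolding pebbling_reachable_def by blast
  from flow_of_pebbling_moves[OF assms(1) this(1)] obtain f
    where "\<forall>u v. f u v \<noteq> 0 \<longrightarrow> u \<rightarrow>\<^bsub>G\<^esub> v"
      and bal: "\<forall>u\<in>verts G. int (Q u) = int (P u) + flow_gain G f u"
    by blast
  then have "pebbling_flow G P f"
    unfolding pebbling_flow_def by (metis of_nat_0_le_iff)
  moreover have "1 \<le> int (P v) + flow_gain G f v"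
    using bal assms(3) \<open>Q v \<ge> 1\<close> by (metis of_nat_1 of_nat_le_iff)
  ultimately show thesis using that by blast
qed

text \<open>
  Each move destroys one pebble, so a flow has at most \<open>|P|\<close> moves in all. This makes the maxima
  over all flows below exist.
\<close>

lemma flow_le_size:
  assumes "graph G" and "pebbling_flow G P f"
  shows "f u v \<le> distribution_size G P"
proof -
  interpret graph G by (rule assms(1))
  let ?T = "\<Sum>u\<in>verts G. \<Sum>v\<in>verts G. int (f u v)"
  have "(\<Sum>u\<in>verts G. flow_gain G f u) = (\<Sum>u\<in>verts G. \<Sum>v\<in>verts G. int (f v u)) - 2 * ?T"
    by (simp add: flow_gain_def sum_subtractf sum_distrib_left)
  also have "(\<Sum>u\<in>verts G. \<Sum>v\<in>verts G. int (f v u)) = ?T"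
    by (rule sum.swap)
  finally have gain: "(\<Sum>u\<in>verts G. flow_gain G f u) = - ?T" by simp
  have "0 \<le> (\<Sum>u\<in>verts G. int (P u) + flow_gain G f u)"
    using assms(2) by (intro sum_nonneg) (auto simp: pebbling_flow_def)
  then have total: "?T \<le> int (distribution_size G P)"
    using gain by (simp add: sum.distrib distribution_size_def)
  show ?thesis
  proof (cases "f u v = 0")
    case False
    then have "u \<in> verts G" "v \<in> verts G"
      using assms(2) adj_in_verts unfolding pebbling_flow_def by blast+
    then have "int (f u v) \<le> (\<Sum>v\<in>verts G. int (f u v))" "(\<Sum>v\<in>verts G. int (f u v)) \<le> ?T"
      by (auto intro!: member_le_sum sum_nonneg)
    then show ?thesis using total by linarith
  qed simp
qed

lemma pebbling_reachable_mono:
  assumes "pebbling_reachable G P v"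
    and arcs: "\<And>a b. a \<rightarrow>\<^bsub>G\<^esub> b \<Longrightarrow> a \<rightarrow>\<^bsub>H\<^esub> b" and "\<And>u. P u \<le> P' u"
  shows "pebbling_reachable H P' v"
proof -
  obtain Q where "(pebbling_move G)\<^sup>*\<^sup>* P Q" and "Q v \<ge> 1"
    using assms(1) unfolding pebbling_reachable_def by blast
  from this(1) have "\<exists>Q'. (pebbling_move H)\<^sup>*\<^sup>* P' Q' \<and> (\<forall>u. Q u \<le> Q' u)"
  proof (induction rule: rtranclp_induct)
    case base
    show ?case using assms(3) by blast
  next
    case (step Q R)
    then obtain Q' where Q': "(pebbling_move H)\<^sup>*\<^sup>* P' Q'" "\<And>u. Q u \<le> Q' u" by blast
    obtain a b where "a \<rightarrow>\<^bsub>G\<^esub> b" and "Q a \<ge> 2" and R: "R = Q(a := Q a - 2, b := Q b + 1)"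
      using step.hyps(2) unfolding pebbling_move_def by blast
    then have "pebbling_move H Q' (Q'(a := Q' a - 2, b := Q' b + 1))"
      unfolding pebbling_move_def using arcs Q'(2)[of a] by fastforce
    moreover have "R u \<le> (Q'(a := Q' a - 2, b := Q' b + 1)) u" for u
      using Q'(2)[of u] by (auto simp: R)
    ultimately show ?case using Q'(1) by (meson rtranclp.rtrancl_into_rtrancl)
  qed
  then show ?thesis
    using \<open>Q v \<ge> 1\<close> unfolding pebbling_reachable_def by (meson le_trans)
qed

section \<open>Strips of three negative diagonals\<close>

definition strip :: "int \<Rightarrow> int \<Rightarrow> (int \<times> int) set" where
  "strip a b = (\<Union>j\<in>{1..3}. neg_diag j) \<inter> (\<Union>i\<in>{a..b}. pos_diag i)"

definition strip_graph :: "int \<Rightarrow> int \<Rightarrow> (int \<times> int, (int \<times> int) \<times> (int \<times> int)) pre_digraph" where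
  "strip_graph a b = with_proj square_grid \<restriction> strip a b"

lemma S_grid_eq_strip: "S_grid 3 n = strip_graph 0 (int n - 1)"
  and S'_grid_eq_strip: "S'_grid 3 n = strip_graph 1 (int n)"
  by (simp_all add: S_grid_def S'_grid_def strip_graph_def strip_def)

lemma in_strip_iff: "(i, j) \<in> strip a b \<longleftrightarrow> 1 \<le> i + j \<and> i + j \<le> 3 \<and> a \<le> i - j \<and> i - j \<le> b"
  by (auto simp: strip_def neg_diag_def pos_diag_def)

lemma verts_strip_graph [simp]: "verts (strip_graph a b) = strip a b"
  by (simp add: strip_graph_def)

lemma graph_strip_graph: "graph (strip_graph a b)"
  unfolding strip_graph_def strip_def by (intro graph_induced_square_grid finite_diag_block)

lemma finite_strip: "finite (strip a b)"
  unfolding strip_def by (rule finite_diag_block)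

lemma adj_strip_graph_iff:
  "(i, j) \<rightarrow>\<^bsub>strip_graph a b\<^esub> (i', j') \<longleftrightarrow>
     (i, j) \<in> strip a b \<and> (i', j') \<in> strip a b \<and> \<bar>i - i'\<bar> + \<bar>j - j'\<bar> = 1"
  by (auto simp: strip_graph_def square_grid_def arcs_ends_def arc_to_ends_def image_iff)

text \<open>
  In the coordinates \<open>i + j\<close> and \<open>i - j\<close> these are the points \<open>(2, 2 m)\<close>, \<open>(1, 2 m + 1)\<close> and
  \<open>(3, 2 m + 1)\<close>.
\<close>

definition cen :: "int \<Rightarrow> int \<times> int" where "cen m = (m + 1, 1 - m)"
definition lo :: "int \<Rightarrow> int \<times> int" where "lo m = (m + 1, - m)"
definition hi :: "int \<Rightarrow> int \<times> int" where "hi m = (m + 2, 1 - m)"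

lemmas vertex_defs = cen_def lo_def hi_def

lemma strip_cases:
  assumes "v \<in> strip a b"
  obtains m where "v = cen m" "a \<le> 2 * m" "2 * m \<le> b"
  | m where "v = lo m" "a \<le> 2 * m + 1" "2 * m + 1 \<le> b"
  | m where "v = hi m" "a \<le> 2 * m + 1" "2 * m + 1 \<le> b"
proof -
  obtain i j where v: "v = (i, j)" by fastforce
  have *: "1 \<le> i + j" "i + j \<le> 3" "a \<le> i - j" "i - j \<le> b"
    using assms by (auto simp: v in_strip_iff)
  consider "i + j = 2" | "i + j = 1" | "i + j = 3" using * by linarith
  then show thesis
  proof cases
    case 1 then show ?thesis using * that(1)[of "i - 1"] by (simp add: v vertex_defs)
  next
    case 2 then show ?thesis using * that(2)[of "i - 1"] by (simp add: v vertex_defs)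
  next
    case 3 then show ?thesis using * that(3)[of "i - 2"] by (simp add: v vertex_defs)
  qed
qed

lemma vertex_in_strip_iff [simp]:
  "cen m \<in> strip a b \<longleftrightarrow> a \<le> 2 * m \<and> 2 * m \<le> b"
  "lo m \<in> strip a b \<longleftrightarrow> a \<le> 2 * m + 1 \<and> 2 * m + 1 \<le> b"
  "hi m \<in> strip a b \<longleftrightarrow> a \<le> 2 * m + 1 \<and> 2 * m + 1 \<le> b"
  by (auto simp: vertex_defs in_strip_iff)

lemma vertex_eq_iff [simp]:
  "cen m = cen m' \<longleftrightarrow> m = m'" "lo m = lo m' \<longleftrightarrow> m = m'" "hi m = hi m' \<longleftrightarrow> m = m'"
  "cen m \<noteq> lo m'" "cen m \<noteq> hi m'" "lo m \<noteq> hi m'"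
  "lo m' \<noteq> cen m" "hi m' \<noteq> cen m" "hi m' \<noteq> lo m"
  by (auto simp: vertex_defs)

lemma sum_strip:
  "(\<Sum>v\<in>strip a b. g v) =
     (\<Sum>m | a \<le> 2 * m \<and> 2 * m \<le> b. g (cen m)) +
     (\<Sum>m | a \<le> 2 * m + 1 \<and> 2 * m + 1 \<le> b. g (lo m) + g (hi m))"
proof -
  let ?M = "{m. a \<le> 2 * m \<and> 2 * m \<le> b}" and ?N = "{m. a \<le> 2 * m + 1 \<and> 2 * m + 1 \<le> b}"
  have fin: "finite ?M" "finite ?N"
    by (rule finite_subset[of _ "{- \<bar>a\<bar> - 1..\<bar>b\<bar>}"]; auto)+
  have strip_eq: "strip a b = cen ` ?M \<union> (lo ` ?N \<union> hi ` ?N)"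
    by (auto elim!: strip_cases)
  show ?thesis
    unfolding strip_eq using fin
    by (subst sum.union_disjoint, auto simp: sum.reindex inj_on_def sum.distrib)+
qed

subsection \<open>Flows on a strip\<close>

text \<open>
  The net number of pebbles that the single vertex to the right (below: to the left) of the \<open>m\<close>-th
  pair receives from this pair.
\<close>

definition gain_right :: "(int \<times> int \<Rightarrow> int \<times> int \<Rightarrow> nat) \<Rightarrow> int \<Rightarrow> int" where
  "gain_right f m = int (f (lo m) (cen (m + 1))) + int (f (hi m) (cen (m + 1)))
     - 2 * (int (f (cen (m + 1)) (lo m)) + int (f (cen (m + 1)) (hi m)))"

definition gain_left :: "(int \<times> int \<Rightarrow> int \<times> int \<Rightarrow> nat) \<Rightarrow> int \<Rightarrow> int" where
  "gain_left f m = int (f (lo m) (cen m)) + int (f (hi m) (cen m))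
     - 2 * (int (f (cen m) (lo m)) + int (f (cen m) (hi m)))"

lemma strip_flow_zero:
  assumes "pebbling_flow (strip_graph a b) P f" and "u \<notin> strip a b \<or> v \<notin> strip a b"
  shows "f u v = 0"
  using assms adj_strip_graph_iff unfolding pebbling_flow_def by (metis surj_pair)

text \<open>
  All four grid neighbours may appear in the sum even where the strip lacks some of them, since a
  flow vanishes outside the strip. Thus no case distinction at the ends of the strip is needed.
\<close>

lemma flow_gain_grid:
  assumes flow: "pebbling_flow (strip_graph a b) P f"
  shows "flow_gain (strip_graph a b) f (i, j) =
    (\<Sum>v\<in>{(i + 1, j), (i - 1, j), (i, j + 1), (i, j - 1)}. int (f v (i, j)) - 2 * int (f (i, j) v))"
  (is "_ = sum ?g ?N")
proof -
  have "?g v = 0" if "v \<notin> ?N" for v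
  proof -
    obtain i' j' where v: "v = (i', j')" by fastforce
    have "\<bar>i - i'\<bar> + \<bar>j - j'\<bar> \<noteq> 1"
      using that by (auto simp: v)
    then have "f v (i, j) = 0" "f (i, j) v = 0"
      using flow unfolding pebbling_flow_def v
      by (metis adj_strip_graph_iff abs_minus_commute)+
    then show ?thesis by simp
  qed
  moreover have "?g v = 0" if "v \<notin> strip a b" for v
    using strip_flow_zero[OF flow] that by simp
  ultimately show ?thesis
    unfolding flow_gain_def by (intro sum.mono_neutral_cong) (auto simp: finite_strip)
qed

lemma flow_gain_cen:
  assumes "pebbling_flow (strip_graph a b) P f"
  shows "flow_gain (strip_graph a b) f (cen m) = gain_right f (m - 1) + gain_left f m"
  unfolding cen_def flow_gain_grid[OF assms]
  by (simp add: gain_right_def gain_left_def vertex_defs algebra_simps)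

lemma flow_gain_lo:
  assumes "pebbling_flow (strip_graph a b) P f"
  shows "flow_gain (strip_graph a b) f (lo m) =
    int (f (cen m) (lo m)) + int (f (cen (m + 1)) (lo m))
    - 2 * (int (f (lo m) (cen m)) + int (f (lo m) (cen (m + 1))))"
proof -
  have "(m, - m) \<notin> strip a b" "(m + 1, - m - 1) \<notin> strip a b"
    by (simp_all add: in_strip_iff)
  then show ?thesis
    unfolding lo_def flow_gain_grid[OF assms]
    using strip_flow_zero[OF assms] by (simp add: vertex_defs algebra_simps)
qed

lemma flow_gain_hi:
  assumes "pebbling_flow (strip_graph a b) P f"
  shows "flow_gain (strip_graph a b) f (hi m) =
    int (f (cen m) (hi m)) + int (f (cen (m + 1)) (hi m))
    - 2 * (int (f (hi m) (cen m)) + int (f (hi m) (cen (m + 1))))"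
proof -
  have "(m + 3, 1 - m) \<notin> strip a b" "(m + 2, 2 - m) \<notin> strip a b"
    by (simp_all add: in_strip_iff)
  then show ?thesis
    unfolding hi_def flow_gain_grid[OF assms]
    using strip_flow_zero[OF assms] by (simp add: vertex_defs algebra_simps)
qed

definition max_gain ::
  "('a, 'b) pre_digraph \<Rightarrow> ('a \<Rightarrow> nat) \<Rightarrow> (('a \<Rightarrow> 'a \<Rightarrow> nat) \<Rightarrow> int) \<Rightarrow> int" where
  "max_gain G P gain = Max (gain ` {f. pebbling_flow G P f})"

lemma pebbling_flow_zero: "pebbling_flow G P (\<lambda>_ _. 0)"
  by (simp add: pebbling_flow_def flow_gain_def)

lemma finite_gains:
  assumes "graph G" and "gain = (\<lambda>f. int (f a x) + int (f b x) - 2 * (int (f x a) + int (f x b)))"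
  shows "finite (gain ` {f. pebbling_flow G P f})"
proof (rule finite_subset)
  let ?s = "int (distribution_size G P)"
  have le: "int (f u v) \<le> ?s" if "pebbling_flow G P f" for f u v
    using flow_le_size[OF assms(1) that] by simp
  have "- 4 * ?s \<le> gain f \<and> gain f \<le> 2 * ?s" if "pebbling_flow G P f" for f
    using le[OF that, of a x] le[OF that, of b x] le[OF that, of x a] le[OF that, of x b]
    unfolding assms(2) by auto
  then show "gain ` {f. pebbling_flow G P f} \<subseteq> {- 4 * ?s..2 * ?s}" by auto
qed simp

lemma finite_gain_left: "finite ((\<lambda>f. gain_left f m) ` {f. pebbling_flow (strip_graph a b) P f})"
  and finite_gain_right: "finite ((\<lambda>f. gain_right f m) ` {f. pebbling_flow (strip_graph a b) P f})"
  by (rule finite_gains[OF graph_strip_graph]; unfold gain_left_def gain_right_def; rule refl)+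

lemma max_gain_ge:
  assumes "finite (gain ` {f. pebbling_flow G P f})" and "pebbling_flow G P f"
  shows "gain f \<le> max_gain G P gain"
  unfolding max_gain_def using assms by (intro Max_ge) auto

lemma max_gain_attained:
  assumes "finite (gain ` {f. pebbling_flow G P f})"
  obtains f where "pebbling_flow G P f" and "gain f = max_gain G P gain"
proof -
  have "max_gain G P gain \<in> gain ` {f. pebbling_flow G P f}"
    unfolding max_gain_def using assms pebbling_flow_zero by (intro Max_in) auto
  then show thesis using that by auto
qed

subsection \<open>The local inequality\<close>

text \<open>
  A flow seen from one pair with \<open>y\<close> and \<open>z\<close> pebbles on its twins. The variables \<open>a\<close> and \<open>b\<close> count
  the moves from the left single vertex into the twins and back, \<open>c\<close> and \<open>d\<close> those from the right
  single vertex and back. The rest of the graph enters only through \<open>q\<close> and \<open>t\<close>, which bound the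
  pebbles available at the left and the right single vertex without the help of this pair.
\<close>

locale pair_flow =
  fixes y z q t a1 a2 b1 b2 c1 c2 d1 d2 :: int
  assumes nonneg: "0 \<le> a1" "0 \<le> a2" "0 \<le> b1" "0 \<le> b2" "0 \<le> c1" "0 \<le> c2" "0 \<le> d1" "0 \<le> d2"
    and first: "2 * b1 + 2 * d1 \<le> y + a1 + c1"
    and second: "2 * b2 + 2 * d2 \<le> z + a2 + c2"
    and left: "2 * a1 + 2 * a2 \<le> q + b1 + b2"
    and right: "2 * c1 + 2 * c2 \<le> t + d1 + d2"
begin

text \<open>
  Moving pebbles back to the left or bringing pebbles in from the right never pays: the left vertex
  contributes at most \<open>q / 2\<close> to the pair, and at most half of the pebbles of the pair arrive on the
  right.
\<close>

lemma gain_le: "4 * (d1 + d2 - 2 * (c1 + c2)) \<le> 2 * (y + z) + q"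
  using nonneg first second left unfolding right_diff_distrib distrib_left by linarith

text \<open>
  The estimate above allows a gain of 1 here. But a twin with one pebble must first receive another
  one. A left vertex with only one pebble of its own cannot send it unless it gets pebbles from the
  pair, and pebbles brought in from the right cost more there than they gain.
\<close>

lemma gain_le_0:
  assumes "y = 1" "z = 1" "q \<le> 1"
  shows "d1 + d2 - 2 * (c1 + c2) \<le> 0"
proof (cases "c1 + c2 = 0 \<and> a1 + a2 = 0")
  case True
  then have "a1 = 0" "a2 = 0" "c1 = 0" "c2 = 0" using nonneg by linarith+
  then have "2 * d1 \<le> 1" "2 * d2 \<le> 1" using nonneg first second assms by linarith+
  then have "d1 \<le> 0" "d2 \<le> 0" by presburger+
  then show ?thesis using \<open>c1 = 0\<close> \<open>c2 = 0\<close> by simp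
next
  case False
  then consider "c1 + c2 \<ge> 1" | "c1 + c2 = 0" "a1 + a2 \<ge> 1" using nonneg by linarith
  then have "2 * (d1 + d2 - 2 * (c1 + c2)) \<le> 1"
    unfolding right_diff_distrib distrib_left
    using nonneg first second left assms by cases linarith+
  then show ?thesis by presburger
qed

lemma swap_sides: "pair_flow y z t q c1 c2 d1 d2 a1 a2 b1 b2"
  using nonneg first second left right by unfold_locales linarith+

lemma swap_twins: "pair_flow z y q t a2 a1 b2 b1 c2 c1 d2 d1"
  using nonneg first second left right by unfold_locales linarith+

text \<open>
  If the second twin is empty and is reached, then a pebble must come in from a single vertex,
  which needs two pebbles there, possibly supplied in part by the first twin. For an empty pair,
  two pebbles split evenly between the two sides do not suffice.
\<close>

lemma incoming:
  assumes reached: "1 + 2 * b2 + 2 * d2 \<le> z + a2 + c2" and "z = 0"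
  shows "y = 0 \<Longrightarrow> q + t \<ge> 2"
    and "y = 0 \<Longrightarrow> q + t = 2 \<Longrightarrow> q \<noteq> 1"
    and "y = 1 \<Longrightarrow> q + t \<ge> 2"
    and "y = 2 \<Longrightarrow> q + t \<ge> 1"
proof -
  have *: "2 * a1 + 2 * c1 + 2 * a2 + 2 * c2 \<le> q + t + b1 + d1 + b2 + d2"
    "1 + 2 * b2 + 2 * d2 \<le> a2 + c2" "2 * b1 + 2 * d1 \<le> y + a1 + c1"
    using left right first assms by linarith+
  show "q + t \<ge> 2" if "y = 0" using * nonneg that by linarith
  show "q + t \<ge> 2" if "y = 1" using * nonneg that by linarith
  show "q + t \<ge> 1" if "y = 2" using * nonneg that by linarith
  show "q \<noteq> 1" if "y = 0" "q + t = 2"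
  proof
    assume "q = 1"
    then have "t = 1" using that by simp
    have "b1 + d1 + b2 + d2 \<le> 0" using * nonneg that by linarith
    then have out: "b1 = 0" "d1 = 0" "b2 = 0" "d2 = 0" using nonneg by linarith+
    then have "2 * a2 \<le> 1" "2 * c2 \<le> 1" using left right nonneg \<open>q = 1\<close> \<open>t = 1\<close> by linarith+
    then have "a2 \<le> 0" "c2 \<le> 0" by presburger+
    moreover have "1 \<le> a2 + c2" using * out by linarith
    ultimately show False by linarith
  qed
qed

end

text \<open>
  The gains \<open>l\<close> and \<open>r\<close> are to the right and to the left. With at least three pebbles on the pair the
  estimates \<open>4 l \<le> 2 (y + z) + q\<close> and \<open>4 r \<le> 2 (y + z) + t\<close> suffice. With fewer, there must be
  pebbles on the sides or, for one pebble on each twin, the sharper bounds on the gains apply. The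
  assumptions \<open>1 \<le> q + r\<close> and \<open>1 \<le> t + l\<close>, which say that the two single vertices are reached, exclude
  the one remaining exception: an empty pair with \<open>q + t = 2\<close>.
\<close>

lemma pair_inequality:
  fixes y z q t l r :: int
  assumes nn: "0 \<le> y" "0 \<le> z" "0 \<le> q" "0 \<le> t"
    and l: "4 * l \<le> 2 * (y + z) + q" "y = 1 \<Longrightarrow> z = 1 \<Longrightarrow> q \<le> 1 \<Longrightarrow> l \<le> 0"
    and r: "4 * r \<le> 2 * (y + z) + t" "y = 1 \<Longrightarrow> z = 1 \<Longrightarrow> t \<le> 1 \<Longrightarrow> r \<le> 0"
    and reach: "y + z \<le> 1 \<Longrightarrow> q + t \<ge> 2" "y + z = 0 \<Longrightarrow> q + t = 2 \<Longrightarrow> q \<noteq> 1"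
      "y + z = 2 \<Longrightarrow> y = 0 \<or> z = 0 \<Longrightarrow> q + t \<ge> 1"
    and ends: "1 \<le> q + r" "1 \<le> t + l"
  shows "3 + l + r \<le> q + t + 2 * (y + z)"
proof -
  consider "y + z = 0" | "y + z = 1" | "y = 1" "z = 1" | "y + z = 2" "y = 0 \<or> z = 0" | "y + z \<ge> 3"
    using nn by linarith
  then show ?thesis
  proof cases
    case 1
    then have s: "4 * l \<le> q" "4 * r \<le> t" "q + t \<ge> 2" using l(1) r(1) reach(1) by auto
    \<comment> \<open>With both pebbles on one side the gain \<open>l\<close> or \<open>r\<close> is 0, and the other single vertex is not reached.\<close>
    have "q + t \<ge> 3"
    proof (rule ccontr)
      assume "\<not> q + t \<ge> 3"
      then have "q + t = 2" using s by simp
      then have "q = 0 \<or> t = 0" using reach(2) 1 nn by auto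
      then show False using s ends \<open>q + t = 2\<close> nn by auto
    qed
    then show ?thesis using s 1 by presburger
  next
    case 2
    then have "4 * l \<le> 2 + q" "4 * r \<le> 2 + t" "q + t \<ge> 2" using l(1) r(1) reach(1) by auto
    then show ?thesis using 2 by presburger
  next
    case 3
    then have "4 * l \<le> 4 + q" "4 * r \<le> 4 + t" using l(1) r(1) by auto
    moreover have "q + t \<ge> 2 \<or> q \<le> 1 \<and> t \<le> 1" using nn by linarith
    ultimately show ?thesis using 3 l(2) r(2) nn by auto
  next
    case 4
    then have "4 * l \<le> 4 + q" "4 * r \<le> 4 + t" "q + t \<ge> 1" using l(1) r(1) reach(3) by auto
    then show ?thesis using 4 by presburger
  next
    case 5
    then show ?thesis using l(1) r(1) nn unfolding distrib_left by linarith
  qed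
qed

section \<open>The lower bound\<close>

locale solvable_odd_strip =
  fixes K :: nat and P :: "int \<times> int \<Rightarrow> nat"
  assumes solvable: "solvable_distribution (strip_graph 0 (2 * int K)) P"
begin

abbreviation "G \<equiv> strip_graph 0 (2 * int K)"
abbreviation "R m \<equiv> max_gain G P (\<lambda>f. gain_right f m)"
abbreviation "L m \<equiv> max_gain G P (\<lambda>f. gain_left f m)"

lemma gain_right_le: "pebbling_flow G P f \<Longrightarrow> gain_right f m \<le> R m"
  and gain_left_le: "pebbling_flow G P f \<Longrightarrow> gain_left f m \<le> L m"
  by (auto intro: max_gain_ge finite_gain_right finite_gain_left)

lemma gain_nonneg: "0 \<le> R m" "0 \<le> L m"
  using gain_right_le[OF pebbling_flow_zero, of m] gain_left_le[OF pebbling_flow_zero, of m]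
  by (simp_all add: gain_right_def gain_left_def)

text \<open>
  Beyond the ends of the strip there are no arcs, which provides the boundary values for the
  telescoping sum.
\<close>

lemma gain_outside:
  shows "R (- 1) = 0" "L (int K) = 0"
proof -
  obtain f where f: "pebbling_flow G P f" "gain_right f (- 1) = R (- 1)"
    using max_gain_attained[OF finite_gain_right] by blast
  then show "R (- 1) = 0"
    using strip_flow_zero[OF f(1)] by (simp add: gain_right_def flip: f(2))
  obtain f where f: "pebbling_flow G P f" "gain_left f (int K) = L (int K)"
    using max_gain_attained[OF finite_gain_left] by blast
  then show "L (int K) = 0"
    using strip_flow_zero[OF f(1)] by (simp add: gain_left_def flip: f(2))
qed

lemma vertex_reached:
  assumes "v \<in> strip 0 (2 * int K)"
  obtains f where "pebbling_flow G P f" "1 \<le> int (P v) + flow_gain G f v"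
  using reachable_imp_flow[OF graph_strip_graph] solvable assms
  unfolding solvable_distribution_def by (metis verts_strip_graph)

text \<open>
  A single vertex separates the graph, so it receives pebbles from the left and from the right
  independently.
\<close>

lemma cen_reached:
  assumes "0 \<le> m" "m \<le> int K"
  shows "1 \<le> int (P (cen m)) + R (m - 1) + L m"
proof -
  obtain f where f: "pebbling_flow G P f" "1 \<le> int (P (cen m)) + flow_gain G f (cen m)"
    using vertex_reached[of "cen m"] assms by auto
  then show ?thesis
    using gain_right_le[OF f(1), of "m - 1"] gain_left_le[OF f(1), of m] flow_gain_cen[OF f(1)]
    by auto
qed

abbreviation (input) "flow_at f m Q \<equiv>
  Q (int (f (cen m) (lo m))) (int (f (cen m) (hi m)))
    (int (f (lo m) (cen m))) (int (f (hi m) (cen m)))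
    (int (f (cen (m + 1)) (lo m))) (int (f (cen (m + 1)) (hi m)))
    (int (f (lo m) (cen (m + 1)))) (int (f (hi m) (cen (m + 1))))"

lemma pair_flow_at:
  assumes f: "pebbling_flow G P f" and m: "0 \<le> m" "m < int K"
  shows "flow_at f m (pair_flow (int (P (lo m))) (int (P (hi m)))
           (int (P (cen m)) + R (m - 1)) (int (P (cen (m + 1))) + L (m + 1)))"
proof -
  have bal: "0 \<le> int (P v) + flow_gain G f v" if "v \<in> strip 0 (2 * int K)" for v
    using f that unfolding pebbling_flow_def by simp
  note * = bal[of "lo m"] bal[of "hi m"] bal[of "cen m"] bal[of "cen (m + 1)"]
    flow_gain_lo[OF f, of m] flow_gain_hi[OF f, of m]
    flow_gain_cen[OF f, of m] flow_gain_cen[OF f, of "m + 1"]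
    gain_right_le[OF f, of "m - 1"] gain_left_le[OF f, of "m + 1"]
  show ?thesis
    using m * gain_right_def[of f m] gain_left_def[of f m] by unfold_locales auto
qed

text \<open>
  Four flows are combined: two that attain the maximal gains and two that reach the twins. All of
  them obey the same bounds \<open>q\<close> and \<open>t\<close>, since these are maxima over all flows.
\<close>

lemma pair_slack:
  assumes m: "0 \<le> m" "m < int K"
  shows "3 + R m + L m \<le> int (P (cen m)) + R (m - 1) + (int (P (cen (m + 1))) + L (m + 1))
           + 2 * (int (P (lo m)) + int (P (hi m)))"
proof (rule pair_inequality)
  let ?y = "int (P (lo m))" and ?z = "int (P (hi m))"
  let ?q = "int (P (cen m)) + R (m - 1)" and ?t = "int (P (cen (m + 1))) + L (m + 1)"
  show "0 \<le> ?q" "0 \<le> ?t" using gain_nonneg by (simp_all add: add_nonneg_nonneg)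
  obtain f where f: "pebbling_flow G P f" "gain_right f m = R m"
    using max_gain_attained[OF finite_gain_right] by blast
  interpret f: pair_flow ?y ?z ?q ?t "int (f (cen m) (lo m))" "int (f (cen m) (hi m))"
    "int (f (lo m) (cen m))" "int (f (hi m) (cen m))"
    "int (f (cen (m + 1)) (lo m))" "int (f (cen (m + 1)) (hi m))"
    "int (f (lo m) (cen (m + 1)))" "int (f (hi m) (cen (m + 1)))"
    by (rule pair_flow_at[OF f(1) m])
  show "4 * R m \<le> 2 * (?y + ?z) + ?q"
    unfolding f(2)[symmetric] gain_right_def[of f m] using f.gain_le .
  show "R m \<le> 0" if "?y = 1" "?z = 1" "?q \<le> 1"
    unfolding f(2)[symmetric] gain_right_def[of f m] using f.gain_le_0[OF that] .
  obtain g where g: "pebbling_flow G P g" "gain_left g m = L m"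
    using max_gain_attained[OF finite_gain_left] by blast
  note g' = pair_flow.swap_sides[OF pair_flow_at[OF g(1) m]]
  show "4 * L m \<le> 2 * (?y + ?z) + ?t"
    unfolding g(2)[symmetric] gain_left_def[of g m] using pair_flow.gain_le[OF g'] .
  show "L m \<le> 0" if "?y = 1" "?z = 1" "?t \<le> 1"
    unfolding g(2)[symmetric] gain_left_def[of g m] using pair_flow.gain_le_0[OF g' that] .
  obtain u where u: "pebbling_flow G P u" "1 \<le> ?z + flow_gain G u (hi m)"
    using vertex_reached[of "hi m"] m by auto
  note hi = pair_flow.incoming[OF pair_flow_at[OF u(1) m]]
  obtain w where w: "pebbling_flow G P w" "1 \<le> ?y + flow_gain G w (lo m)"
    using vertex_reached[of "lo m"] m by auto
  note lo = pair_flow.incoming[OF pair_flow.swap_twins[OF pair_flow_at[OF w(1) m]]]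
  have hi_reached: "1 + 2 * int (u (hi m) (cen m)) + 2 * int (u (hi m) (cen (m + 1)))
      \<le> ?z + int (u (cen m) (hi m)) + int (u (cen (m + 1)) (hi m))"
    using u(2) flow_gain_hi[OF u(1), of m] by simp
  have lo_reached: "1 + 2 * int (w (lo m) (cen m)) + 2 * int (w (lo m) (cen (m + 1)))
      \<le> ?y + int (w (cen m) (lo m)) + int (w (cen (m + 1)) (lo m))"
    using w(2) flow_gain_lo[OF w(1), of m] by simp
  note hi = hi[OF hi_reached] and lo = lo[OF lo_reached]
  show "2 \<le> ?q + ?t" if "?y + ?z \<le> 1"
  proof (cases "?z = 0")
    case True
    then show ?thesis using hi(1) hi(3) that by linarith
  next
    case False
    then show ?thesis using lo(3) that by linarith
  qed
  show "?q \<noteq> 1" if "?y + ?z = 0" "?q + ?t = 2"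
    using hi(2) that by linarith
  show "1 \<le> ?q + ?t" if "?y + ?z = 2" "?y = 0 \<or> ?z = 0"
    using that(2)
  proof
    assume "?y = 0"
    then show ?thesis using lo(4) that(1) by linarith
  next
    assume "?z = 0"
    then show ?thesis using hi(4) that(1) by linarith
  qed
  show "1 \<le> ?q + L m" "1 \<le> ?t + R m"
    using cen_reached[of m] cen_reached[of "m + 1"] m by (simp_all add: add_ac)
qed simp_all

lemma int_index_set:
  "{m. 0 \<le> 2 * m \<and> 2 * m \<le> 2 * int K} = int ` {..K}"
  "{m. 0 \<le> 2 * m + 1 \<and> 2 * m + 1 \<le> 2 * int K} = int ` {..<K}"
proof -
  have "{m. 0 \<le> 2 * m \<and> 2 * m \<le> 2 * int K} = {int 0..<int (Suc K)}" by auto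
  then show "{m. 0 \<le> 2 * m \<and> 2 * m \<le> 2 * int K} = int ` {..K}"
    by (metis image_int_atLeastLessThan atLeast0LessThan lessThan_Suc_atMost)
  have "{m. 0 \<le> 2 * m + 1 \<and> 2 * m + 1 \<le> 2 * int K} = {int 0..<int K}" by auto
  then show "{m. 0 \<le> 2 * m + 1 \<and> 2 * m + 1 \<le> 2 * int K} = int ` {..<K}"
    by (metis image_int_atLeastLessThan atLeast0LessThan)
qed

text \<open>
  Every inner \<open>x\<^sub>m\<close> occurs in the inequalities of two pairs, \<open>x\<^sub>0\<close> and \<open>x\<^sub>K\<close> in one each; the
  inequalities for the end vertices supply the missing copies and the constant 2.
\<close>

lemma size_lower_bound: "3 * K + 2 \<le> 2 * distribution_size G P"
proof -
  define x p where "x n = int (P (cen (int n)))" and "p n = int (P (lo (int n))) + int (P (hi (int n)))" for n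
  have "3 * int n + R (int n - 1) + L 0 \<le>
      (\<Sum>i<n. x i + x (Suc i) + 2 * p i) + R (- 1) + L (int n)" if "n \<le> K" for n
    using that
  proof (induction n)
    case (Suc n)
    then show ?case using pair_slack[of "int n"] by (simp add: x_def p_def add_ac)
  qed simp
  from this[of K] have 1: "3 * int K + R (int K - 1) + L 0 \<le> (\<Sum>i<K. x i + x (Suc i) + 2 * p i)"
    by (simp add: gain_outside)
  have 2: "1 \<le> x 0 + L 0" "1 \<le> x K + R (int K - 1)"
    using cen_reached[of 0] cen_reached[of "int K"] by (simp_all add: gain_outside x_def)
  have "(\<Sum>i<K. x i) + x K = (\<Sum>i\<le>K. x i)"
    by (simp add: lessThan_Suc_atMost[symmetric])
  moreover have "x 0 + (\<Sum>i<K. x (Suc i)) = (\<Sum>i\<le>K. x i)"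
    by (metis lessThan_Suc_atMost sum.lessThan_Suc_shift)
  ultimately have "3 * int K + 2 \<le> 2 * (\<Sum>i\<le>K. x i) + 2 * (\<Sum>i<K. p i)"
    using 1 2 by (simp add: sum.distrib sum_distrib_left[symmetric])
  also have "\<dots> = 2 * int (distribution_size G P)"
    unfolding distribution_size_def verts_strip_graph sum_strip int_index_set
    by (simp add: sum.reindex x_def p_def)
  finally show ?thesis by linarith
qed

end

text \<open>
  One pebble on each new vertex; the old moves remain available.
\<close>

lemma solvable_distribution_extend:
  assumes solv: "solvable_distribution (strip_graph c d) P"
    and sub: "strip c d \<subseteq> strip a b"
  defines "E \<equiv> strip a b - strip c d"
  shows "\<exists>P'. solvable_distribution (strip_graph a b) P' \<and>
              distribution_size (strip_graph a b) P' = distribution_size (strip_graph c d) P + card E"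
proof -
  have new: "strip a b - strip c d = E" by (simp add: E_def)
  define P' where "P' = (\<lambda>v. if v \<in> E then 1 else P v)"
  have out: "P v = 0" if "v \<notin> strip c d" for v
    using solv that unfolding solvable_distribution_def pebbling_distribution_def verts_strip_graph by blast
  have "pebbling_reachable (strip_graph a b) P' v" if "v \<in> strip a b" for v
  proof (cases "v \<in> E")
    case True
    then show ?thesis
      unfolding pebbling_reachable_def by (intro exI[of _ P']) (simp add: P'_def)
  next
    case False
    then have "pebbling_reachable (strip_graph c d) P v"
      using that new solv by (auto simp: solvable_distribution_def)
    then show ?thesis
    proof (rule pebbling_reachable_mono)
      fix u w :: "int \<times> int"
      show "u \<rightarrow>\<^bsub>strip_graph a b\<^esub> w" if "u \<rightarrow>\<^bsub>strip_graph c d\<^esub> w"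
        using that sub by (cases u; cases w) (auto simp: adj_strip_graph_iff)
      show "P u \<le> P' u"
        using new out[of u] by (auto simp: P'_def)
    qed
  qed
  then have "solvable_distribution (strip_graph a b) P'"
    unfolding solvable_distribution_def pebbling_distribution_def P'_def verts_strip_graph
    using new sub out by fastforce
  moreover have "(\<Sum>v\<in>strip a b. P' v) = (\<Sum>v\<in>strip c d. P v) + card E"
  proof -
    have "(\<Sum>v\<in>strip a b. P' v) = (\<Sum>v\<in>E. P' v) + (\<Sum>v\<in>strip c d. P' v)"
      using sum.subset_diff[OF sub finite_strip] new by blast
    moreover have "(\<Sum>v\<in>strip c d. P' v) = (\<Sum>v\<in>strip c d. P v)"
      using new by (intro sum.cong) (auto simp: P'_def)
    ultimately show ?thesis by (simp add: P'_def)
  qed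
  ultimately show ?thesis by (auto simp: distribution_size_def)
qed

text \<open>
  At each end where the strip stops with a pair, a single vertex with one pebble is added. The term
  \<open>c + (2 K - d)\<close> counts these vertices.
\<close>

lemma strip_lower_bound:
  assumes solv: "solvable_distribution (strip_graph c d) P"
    and c: "c = 0 \<or> c = 1" and d: "d = 2 * int K \<or> d = 2 * int K - 1"
  shows "3 * int K + 2 \<le> 2 * (int (distribution_size (strip_graph c d) P) + c + (2 * int K - d))"
proof -
  have new: "strip 0 (2 * int K) - strip c d =
      (if c = 1 then {cen 0} else {}) \<union> (if d = 2 * int K - 1 then {cen (int K)} else {})"
    (is "_ = ?E")
  proof (intro set_eqI iffI)
    fix v assume "v \<in> strip 0 (2 * int K) - strip c d"
    then have v: "v \<in> strip 0 (2 * int K)" "v \<notin> strip c d" by auto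
    show "v \<in> ?E"
    proof (cases rule: strip_cases[OF v(1)])
      case (1 m)
      then show ?thesis using v(2) c d by auto
    next
      case (2 m)
      have "c \<le> 2 * m + 1 \<and> 2 * m + 1 \<le> d" using 2(2,3) c d by presburger
      then show ?thesis using v(2) 2(1) by simp
    next
      case (3 m)
      have "c \<le> 2 * m + 1 \<and> 2 * m + 1 \<le> d" using 3(2,3) c d by presburger
      then show ?thesis using v(2) 3(1) by simp
    qed
  qed (use c d in \<open>auto split: if_splits\<close>)
  have sub: "strip c d \<subseteq> strip 0 (2 * int K)"
    using c d by (auto simp: in_strip_iff)
  have "int (card ?E) \<le> c + (2 * int K - d)"
    using c d by (auto simp: card_insert_if)
  moreover obtain P' where "solvable_distribution (strip_graph 0 (2 * int K)) P'"
    "distribution_size (strip_graph 0 (2 * int K)) P' = distribution_size (strip_graph c d) P + card ?E"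
    using solvable_distribution_extend[OF solv sub] new by metis
  ultimately show ?thesis using solvable_odd_strip.size_lower_bound[of K P'] by (simp add: solvable_odd_strip_def)
qed

section \<open>The upper bound\<close>

text \<open>
  The condition \<open>i + j = 2\<close> selects the single vertices \<open>cen m\<close>, whose index is \<open>m = i - 1\<close>.
\<close>

definition central :: "int \<Rightarrow> int \<Rightarrow> (int \<Rightarrow> nat) \<Rightarrow> int \<times> int \<Rightarrow> nat" where
  "central a b w v = (if v \<in> strip a b \<and> fst v + snd v = 2 then w (fst v - 1) else 0)"

lemma central_solvable:
  assumes pos: "\<And>m. a \<le> 2 * m \<Longrightarrow> 2 * m \<le> b \<Longrightarrow> 1 \<le> w m"
    and two: "\<And>m. a \<le> 2 * m + 1 \<Longrightarrow> 2 * m + 1 \<le> b \<Longrightarrow>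
        (\<exists>m'\<in>{m, m + 1}. a \<le> 2 * m' \<and> 2 * m' \<le> b \<and> 2 \<le> w m')"
  shows "solvable_distribution (strip_graph a b) (central a b w)"
proof -
  let ?G = "strip_graph a b" and ?P = "central a b w"
  have cen: "?P (cen m) = w m" if "a \<le> 2 * m" "2 * m \<le> b" for m
    using that unfolding central_def by (auto simp: cen_def in_strip_iff)
  have step: "pebbling_reachable ?G ?P v" if "u \<rightarrow>\<^bsub>?G\<^esub> v" "2 \<le> ?P u" for u v
  proof -
    have "pebbling_move ?G ?P (?P(u := ?P u - 2, v := ?P v + 1))"
      unfolding pebbling_move_def using that by blast
    then show ?thesis
      unfolding pebbling_reachable_def
      by (intro exI[of _ "?P(u := ?P u - 2, v := ?P v + 1)"]) (simp add: r_into_rtranclp)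
  qed
  have "pebbling_reachable ?G ?P v" if "v \<in> strip a b" for v
    using that
  proof (cases rule: strip_cases)
    case (1 m)
    then show ?thesis
      unfolding pebbling_reachable_def using pos[of m] cen[of m] by (intro exI[of _ ?P]) simp
  next
    case (2 m)
    then obtain m' where m': "m' \<in> {m, m + 1}" "a \<le> 2 * m'" "2 * m' \<le> b" "2 \<le> w m'"
      using two by blast
    then have "cen m' \<rightarrow>\<^bsub>?G\<^esub> v"
      using 2 by (auto simp: vertex_defs adj_strip_graph_iff in_strip_iff)
    then show ?thesis using step cen m' by simp
  next
    case (3 m)
    then obtain m' where m': "m' \<in> {m, m + 1}" "a \<le> 2 * m'" "2 * m' \<le> b" "2 \<le> w m'"
      using two by blast
    then have "cen m' \<rightarrow>\<^bsub>?G\<^esub> v"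
      using 3 by (auto simp: vertex_defs adj_strip_graph_iff in_strip_iff)
    then show ?thesis using step cen m' by simp
  qed
  then show ?thesis
    by (simp add: solvable_distribution_def pebbling_distribution_def central_def)
qed

lemma central_size:
  "distribution_size (strip_graph a b) (central a b w) = (\<Sum>m | a \<le> 2 * m \<and> 2 * m \<le> b. w m)"
proof -
  have "central a b w (cen m) = w m" if "a \<le> 2 * m \<and> 2 * m \<le> b" for m
    using that unfolding central_def by (auto simp: cen_def in_strip_iff)
  moreover have "central a b w (lo m) = 0" "central a b w (hi m) = 0" for m
    by (simp_all add: central_def lo_def hi_def)
  ultimately show ?thesis
    by (simp add: distribution_size_def sum_strip)
qed

text \<open>
  The case \<open>2 m + 1 = b\<close> concerns the single vertex before a final pair: for even \<open>m\<close> there is no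
  vertex with two pebbles after that pair, so the second pebble is put here.
\<close>

definition ones_and_twos :: "int \<Rightarrow> int \<Rightarrow> nat" where
  "ones_and_twos b m = (if odd m \<or> 2 * m + 1 = b then 2 else 1)"

lemma ones_and_twos_solvable:
  assumes "a = 0 \<or> a = 1" and "2 \<le> b \<or> a = 0"
  shows "solvable_distribution (strip_graph a b) (central a b (ones_and_twos b))"
proof (rule central_solvable)
  fix m assume m: "a \<le> 2 * m + 1" "2 * m + 1 \<le> b"
  consider "odd m" | "even m" "2 * m + 1 = b" | "even m" "2 * m + 2 \<le> b" using m by linarith
  then show "\<exists>m'\<in>{m, m + 1}. a \<le> 2 * m' \<and> 2 * m' \<le> b \<and> 2 \<le> ones_and_twos b m'"
  proof cases
    case 1
    then have "m \<noteq> 0" by auto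
    then show ?thesis using 1 m assms(1) by (intro bexI[of _ m]) (auto simp: ones_and_twos_def)
  next
    case 2
    then show ?thesis using m assms by (intro bexI[of _ m]) (auto simp: ones_and_twos_def)
  next
    case 3
    then show ?thesis using m by (intro bexI[of _ "m + 1"]) (auto simp: ones_and_twos_def)
  qed
qed (simp add: ones_and_twos_def)

text \<open>
  The \<open>N\<close> single vertices carry one pebble each, the \<open>N div 2\<close> of odd index another one, and the
  correction before a final pair is an extra pebble exactly if \<open>b mod 4 = 1\<close>.
\<close>

lemma sum_ones_and_twos:
  fixes b :: nat
  defines "N \<equiv> b div 2 + 1"
  shows "(\<Sum>m | 0 \<le> 2 * m \<and> 2 * m \<le> int b. ones_and_twos (int b) m)
           = N + N div 2 + (if b mod 4 = 1 then 1 else 0)"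
proof -
  have "{m. 0 \<le> 2 * m \<and> 2 * m \<le> int b} = {int 0..<int N}"
    by (auto simp: N_def)
  then have "{m. 0 \<le> 2 * m \<and> 2 * m \<le> int b} = int ` {..<N}"
    by (metis image_int_atLeastLessThan atLeast0LessThan)
  then have "(\<Sum>m | 0 \<le> 2 * m \<and> 2 * m \<le> int b. ones_and_twos (int b) m)
      = (\<Sum>i<N. ones_and_twos (int b) (int i))"
    by (simp add: sum.reindex)
  also have "\<dots> = (\<Sum>i<N. (if odd i then 2 else 1) +
      (if i = b div 2 then if b mod 4 = 1 then 1 else 0 else 0))"
  proof (rule sum.cong)
    fix i
    have "even i \<and> 2 * i + 1 = b \<longleftrightarrow> i = b div 2 \<and> b mod 4 = 1" by presburger
    moreover have "2 * int i + 1 = int b \<longleftrightarrow> 2 * i + 1 = b" by linarith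
    ultimately show "ones_and_twos (int b) (int i) = (if odd i then 2 else 1) +
        (if i = b div 2 then if b mod 4 = 1 then 1 else 0 else 0)"
      by (auto simp: ones_and_twos_def)
  qed simp
  also have "\<dots> = (\<Sum>i<N. if odd i then 2 else 1) + (if b mod 4 = 1 then 1 else 0)"
    by (simp add: sum.distrib N_def)
  also have "(\<Sum>i<n. if odd i then 2 else 1) = n + n div 2" for n :: nat
    by (induction n) auto
  finally show ?thesis .
qed

lemma optimal_pebbling_number_eqI:
  assumes "solvable_distribution G P" and "distribution_size G P = s"
    and "\<And>Q. solvable_distribution G Q \<Longrightarrow> s \<le> distribution_size G Q"
  shows "optimal_pebbling_number G = s"
  unfolding optimal_pebbling_number_def using assms by (intro Least_equality) auto

theorem theorem2p1:
  fixes k r :: nat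
  assumes "r \<in> {0, 1, 2, 3}"
    and "4 * k + r \<ge> 2"
  shows "optimal_pebbling_number (S_grid 3 (4 * k + r)) = 3 * k + r \<and>
         optimal_pebbling_number (S'_grid 3 (4 * k + r)) = (if r = 3 then 3 * k + 2 else 3 * k + r)"
proof
  let ?n = "4 * k + r"
  have r: "r = 0 \<or> r = 1 \<or> r = 2 \<or> r = 3" using assms(1) by simp
  have b: "int ?n - 1 = int (?n - 1)" using assms(2) by simp
  show "optimal_pebbling_number (S_grid 3 ?n) = 3 * k + r"
    unfolding S_grid_eq_strip b
  proof (rule optimal_pebbling_number_eqI)
    let ?b = "int (?n - 1)"
    show "solvable_distribution (strip_graph 0 ?b) (central 0 ?b (ones_and_twos ?b))"
      by (rule ones_and_twos_solvable) auto
    show "distribution_size (strip_graph 0 ?b) (central 0 ?b (ones_and_twos ?b)) = 3 * k + r"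
      unfolding central_size sum_ones_and_twos
      using r assms(2) by (elim disjE, cases k) (simp_all, presburger)
    fix Q assume Q: "solvable_distribution (strip_graph 0 ?b) Q"
    \<comment> \<open>The number of pairs; the strip ends with column \<open>2 K\<close> or \<open>2 K - 1\<close>.\<close>
    define K where "K = (4 * k + r) div 2"
    have d: "?b = 2 * int K \<or> ?b = 2 * int K - 1"
      unfolding K_def using assms(2) by presburger
    show "3 * k + r \<le> distribution_size (strip_graph 0 ?b) Q"
      using strip_lower_bound[OF Q _ d] r assms(2) by (auto simp: K_def)
  qed
  show "optimal_pebbling_number (S'_grid 3 ?n) = (if r = 3 then 3 * k + 2 else 3 * k + r)"
    unfolding S'_grid_eq_strip
  proof (rule optimal_pebbling_number_eqI)
    let ?b = "int ?n" and ?s = "if r = 3 then 3 * k + 2 else 3 * k + r"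
    show "solvable_distribution (strip_graph 1 ?b) (central 1 ?b (ones_and_twos ?b))"
      using assms(2) by (intro ones_and_twos_solvable) auto
    have mod_4: "?n mod 4 = r" using r by auto
    \<comment> \<open>The strip lacks the vertex \<open>cen 0\<close>, which would carry one pebble.\<close>
    have fin: "finite {m :: int. 1 \<le> 2 * m \<and> 2 * m \<le> ?b}"
      by (rule finite_subset[of _ "{0..?b}"]) auto
    have "{m. 0 \<le> 2 * m \<and> 2 * m \<le> ?b} = insert 0 {m. 1 \<le> 2 * m \<and> 2 * m \<le> ?b}" by auto
    then have "(\<Sum>m | 0 \<le> 2 * m \<and> 2 * m \<le> ?b. ones_and_twos ?b m)
        = 1 + (\<Sum>m | 1 \<le> 2 * m \<and> 2 * m \<le> ?b. ones_and_twos ?b m)"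
      using fin assms(2) by (simp add: ones_and_twos_def)
    then show "distribution_size (strip_graph 1 ?b) (central 1 ?b (ones_and_twos ?b)) = ?s"
      unfolding central_size sum_ones_and_twos mod_4 using r by (elim disjE) simp_all
    fix Q assume Q: "solvable_distribution (strip_graph 1 ?b) Q"
    define K where "K = (4 * k + r + 1) div 2"
    have d: "?b = 2 * int K \<or> ?b = 2 * int K - 1"
      unfolding K_def by presburger
    show "?s \<le> distribution_size (strip_graph 1 ?b) Q"
      using strip_lower_bound[OF Q _ d] r by (auto simp: K_def)
  qed
qed

end
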